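(* Let $\mathbb{K}$ be an algebraically closed field, $V$ a $\mathbb{K}$-vector space of finite positive dimension, and $\Phi=(A;\{E_i\}_{i=0}^d;A^*;\{E_i^*\}_{i=0}^d)$ a TD system on $V$ of diameter $d\geq 1$ that has $q$-Racah type, with fixed associated scalars $q,a,b$. Let $\psi\in\mathrm{End}(V)$ and the subspaces $W_i$ be as defined in the context. Then for $0\leq i\leq d$, $$\psi W_i\subseteq W_{i-1}.$$
   Context: TD pair: an ordered pair of linear maps $A,A^*:V\to V$ such that (i) each is diagonalizable; (ii) there is an ordering $\{V_i\}_{i=0}^d$ of the eigenspaces of $A$ with $A^*V_i\subseteq V_{i-1}+V_i+V_{i+1}$ for $0\le i\le d$ ($V_{-1}=V_{d+1}=0$); (iii) there is an ordering $\{V_i^*\}_{i=0}^\delta$ of the eigenspaces of $A^*$ with $AV_i^*\subseteq V_{i-1}^*+V_i^*+V_{i+1}^*$ for $0\le i\le\delta$ ($V^*_{-1}=V^*_{\delta+1}=0$); (iv) no subspace $W$ with $0\ne W\ne V$ satisfies $AW\subseteq W$ and $A^*W\subseteq W$. It is known that $d=\delta$; $d$ is called the diameter. Orderings as in (ii), (iii) are called standard. The primitive idempotent of $A$ for an eigenspace $V_i$ is the projection of $V$ onto $V_i$ that vanishes on the other eigenspaces (similarly for $A^*$). TD system: $(A;\{E_i\}_{i=0}^d;A^*;\{E_i^*\}_{i=0}^d)$ where $A,A^*$ is a TD pair and $\{E_i\}$, $\{E_i^*\}$ are the primitive idempotents of $A$, $A^*$, in orders for which the corresponding eigenspace orderings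 $\{E_iV\}$, $\{E_i^*V\}$ are standard. Let $\theta_i$ (resp. $\theta_i^*$) be the eigenvalue of $A$ on $E_iV$ (resp. of $A^*$ on $E_i^*V$). $\Phi$ has $q$-Racah type if there are nonzero $q,a,b\in\mathbb{K}$ with $q^4\ne1$ and $\theta_i=aq^{d-2i}+a^{-1}q^{2i-d}$, $\theta_i^*=bq^{d-2i}+b^{-1}q^{2i-d}$ for $0\le i\le d$. (Distinctness of eigenvalues forces $q^{2i}\neq1$ for $1\le i\le d$, and $a^2\ne q^{2d-2},q^{2d-4},\dots,q^{2-2d}$; in particular $a^2\neq 1$.) Split decompositions: $U_i=(E_0^*V+\cdots+E_i^*V)\cap(E_iV+\cdots+E_dV)$ and $U_i^\Downarrow=(E_0^*V+\cdots+E_i^*V)\cap(E_0V+\cdots+E_{d-i}V)$ for $0\le i\le d$. It is known that $V=\bigoplus_i U_i=\bigoplus_i U_i^\Downarrow$ with all summands nonzero. $K,B\in\mathrm{End}(V)$ are the linear maps acting on $U_i$, respectively $U_i^\Downarrow$, as the scalar $q^{d-2i}$ ($0\le i\le d$). $\psi\in\mathrm{End}(V)$: $\psi=(I-BK^{-1})\,\bigl(q(aI-a^{-1}BK^{-1})\bigr)^{-1}$ (the inverse is known to exist; it is known that $\psi$ also equals $q(I-K^{-1}B)(aI-a^{-1}K^{-1}B)^{-1}$, $(I-KB^{-1})(q(a^{-1}I-aKB^{-1}))^{-1}$ and $q(I-B^{-1}K)(a^{-1}I-aB^{-1}K)^{-1}$). $\mathcal{M}=\dfrac{aK-a^{-1}B}{a-a^{-1}}\in\mathrm{End}(V)$,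 and $W_i=\{v\in V:\mathcal{M}v=q^{d-2i}v\}$ is the eigenspace of $\mathcal{M}$ for the eigenvalue $q^{d-2i}$ ($0\le i\le d$); $W_{-1}=0$, $W_{d+1}=0$. *)

theory Defs
  imports
    "HOL-Computational_Algebra.Polynomial"
    "HOL-Library.Set_Algebras"
begin

text \<open>
  Sums of subspaces are the setwise (Minkowski) sums of \<^theory>\<open>HOL-Library.Set_Algebras\<close>;
  in particular \<^term>\<open>\<Sum>j\<in>J. X j\<close> is \<^term>\<open>{0}\<close> for empty \<open>J\<close>.
\<close>

text \<open>
  A family \<open>X\<^sub>0, \<dots>, X\<^sub>d\<close> of subspaces, extended by zero to all integer indices, so that
  \<open>X\<^sub>-\<^sub>1 = X\<^sub>d\<^sub>+\<^sub>1 = {0}\<close>.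
\<close>
definition zero_ext ::
    "nat \<Rightarrow> (nat \<Rightarrow> 'b::zero set) \<Rightarrow> int \<Rightarrow> 'b set" where
  "zero_ext d X j = (if 0 \<le> j \<and> j \<le> int d then X (nat j) else {0})"

text \<open>The split decompositions; \<open>E\<close> and \<open>Es\<close> are the primitive idempotents of \<open>A\<close> and \<open>A\<^sup>*\<close>.\<close>

definition split_U ::
    "nat \<Rightarrow> (nat \<Rightarrow> 'b \<Rightarrow> 'b) \<Rightarrow> (nat \<Rightarrow> 'b \<Rightarrow> 'b) \<Rightarrow> nat \<Rightarrow> 'b::comm_monoid_add set" where
  "split_U d E Es i = (\<Sum>j\<in>{0..i}. range (Es j)) \<inter> (\<Sum>j\<in>{i..d}. range (E j))"

definition split_U_down ::
    "nat \<Rightarrow> (nat \<Rightarrow> 'b \<Rightarrow> 'b) \<Rightarrow> (nat \<Rightarrow> 'b \<Rightarrow> 'b) \<Rightarrow> nat \<Rightarrow> 'b::comm_monoid_add set" where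
  "split_U_down d E Es i = (\<Sum>j\<in>{0..i}. range (Es j)) \<inter> (\<Sum>j\<in>{0..d - i}. range (E j))"

definition eigenspace ::
    "('a::field \<Rightarrow> 'b::ab_group_add \<Rightarrow> 'b) \<Rightarrow> ('b \<Rightarrow> 'b) \<Rightarrow> 'a \<Rightarrow> 'b set" where
  "eigenspace scale f \<theta> = {v. f v = scale \<theta> v}"

definition eigenspaces ::
    "('a::field \<Rightarrow> 'b::ab_group_add \<Rightarrow> 'b) \<Rightarrow> ('b \<Rightarrow> 'b) \<Rightarrow> 'b set set" where
  "eigenspaces scale f = {eigenspace scale f \<theta> | \<theta>. eigenspace scale f \<theta> \<noteq> {0}}"

definition diagonalizable ::
    "('a::field \<Rightarrow> 'b::ab_group_add \<Rightarrow> 'b) \<Rightarrow> ('b \<Rightarrow> 'b) \<Rightarrow> bool" where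
  "diagonalizable scale f \<longleftrightarrow> module.span scale (\<Union> (eigenspaces scale f)) = UNIV"

text \<open>
  \<open>X\<^sub>0, \<dots>, X\<^sub>d\<close> is an ordering (without repetition) of the eigenspaces of \<open>f\<close> on which \<open>g\<close> acts
  in a block-tridiagonal way.
\<close>
definition standard_ordering ::
    "('a::field \<Rightarrow> 'b::ab_group_add \<Rightarrow> 'b) \<Rightarrow> ('b \<Rightarrow> 'b) \<Rightarrow> ('b \<Rightarrow> 'b) \<Rightarrow> nat \<Rightarrow> (nat \<Rightarrow> 'b set) \<Rightarrow> bool" where
  "standard_ordering scale f g d X \<longleftrightarrow>
     bij_betw X {0..d} (eigenspaces scale f) \<and>
     (\<forall>i\<le>d. g ` X i \<subseteq>
        zero_ext d X (int i - 1) + zero_ext d X (int i) + zero_ext d X (int i + 1))"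

definition td_pair ::
    "('a::field \<Rightarrow> 'b::ab_group_add \<Rightarrow> 'b) \<Rightarrow> ('b \<Rightarrow> 'b) \<Rightarrow> ('b \<Rightarrow> 'b) \<Rightarrow> bool" where
  "td_pair scale A As \<longleftrightarrow>
     Vector_Spaces.linear scale scale A \<and> Vector_Spaces.linear scale scale As \<and>
     diagonalizable scale A \<and> diagonalizable scale As \<and>
     (\<exists>d X. standard_ordering scale A As d X) \<and>
     (\<exists>\<delta> Xs. standard_ordering scale As A \<delta> Xs) \<and>
     \<not> (\<exists>W. module.subspace scale W \<and> W \<noteq> {0} \<and> W \<noteq> UNIV \<and> A ` W \<subseteq> W \<and> As ` W \<subseteq> W)"

text \<open>\<open>P\<close> is the projection onto the eigenspace \<open>S\<close> of \<open>f\<close> along the other eigenspaces.\<close>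
definition primitive_idempotent ::
    "('a::field \<Rightarrow> 'b::ab_group_add \<Rightarrow> 'b) \<Rightarrow> ('b \<Rightarrow> 'b) \<Rightarrow> 'b set \<Rightarrow> ('b \<Rightarrow> 'b) \<Rightarrow> bool" where
  "primitive_idempotent scale f S P \<longleftrightarrow>
     S \<in> eigenspaces scale f \<and> Vector_Spaces.linear scale scale P \<and> range P = S \<and>
     (\<forall>v\<in>S. P v = v) \<and> (\<forall>T\<in>eigenspaces scale f. T \<noteq> S \<longrightarrow> (\<forall>v\<in>T. P v = 0))"

definition td_system ::
    "('a::field \<Rightarrow> 'b::ab_group_add \<Rightarrow> 'b) \<Rightarrow> nat \<Rightarrow> ('b \<Rightarrow> 'b) \<Rightarrow> (nat \<Rightarrow> 'b \<Rightarrow> 'b) \<Rightarrow>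
     ('b \<Rightarrow> 'b) \<Rightarrow> (nat \<Rightarrow> 'b \<Rightarrow> 'b) \<Rightarrow> bool" where
  "td_system scale d A E As Es \<longleftrightarrow>
     td_pair scale A As \<and>
     (\<forall>i\<le>d. primitive_idempotent scale A (range (E i)) (E i)) \<and>
     (\<forall>i\<le>d. primitive_idempotent scale As (range (Es i)) (Es i)) \<and>
     standard_ordering scale A As d (\<lambda>i. range (E i)) \<and>
     standard_ordering scale As A d (\<lambda>i. range (Es i))"

text \<open>
  The eigenvalues \<open>\<theta>\<^sub>i\<close> and \<open>\<theta>\<^sub>i\<^sup>*\<close> are not named: as \<^term>\<open>range (E i)\<close> is a nonzero eigenspace
  of \<open>A\<close>, the scalar by which \<open>A\<close> acts on it is uniquely determined (similarly for \<open>A\<^sup>*\<close>).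
\<close>
definition q_Racah_type ::
    "('a::field \<Rightarrow> 'b::ab_group_add \<Rightarrow> 'b) \<Rightarrow> nat \<Rightarrow> ('b \<Rightarrow> 'b) \<Rightarrow> (nat \<Rightarrow> 'b \<Rightarrow> 'b) \<Rightarrow>
     ('b \<Rightarrow> 'b) \<Rightarrow> (nat \<Rightarrow> 'b \<Rightarrow> 'b) \<Rightarrow>
     'a \<Rightarrow> 'a \<Rightarrow> 'a \<Rightarrow> bool" where
  "q_Racah_type scale d A E As Es q a b \<longleftrightarrow>
     q \<noteq> 0 \<and> a \<noteq> 0 \<and> b \<noteq> 0 \<and> q ^ 4 \<noteq> 1 \<and>
     (\<forall>i\<le>d. \<forall>v\<in>range (E i).
        A v = scale (a * q powi (int d - 2 * int i) + inverse a * q powi (2 * int i - int d)) v) \<and>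
     (\<forall>i\<le>d. \<forall>v\<in>range (Es i).
        As v = scale (b * q powi (int d - 2 * int i) + inverse b * q powi (2 * int i - int d)) v)"

text \<open>
  \<open>F\<close> is the linear map acting on \<open>X\<^sub>i\<close> as \<open>q\<^sup>d\<^sup>-\<^sup>2\<^sup>i\<close>. If the space is the direct sum of
  \<open>X\<^sub>0, \<dots>, X\<^sub>d\<close>, there is exactly one such \<open>F\<close>.
\<close>
definition q_weight_map ::
    "('a::field \<Rightarrow> 'b::ab_group_add \<Rightarrow> 'b) \<Rightarrow> nat \<Rightarrow> 'a \<Rightarrow> (nat \<Rightarrow> 'b set) \<Rightarrow> ('b \<Rightarrow> 'b) \<Rightarrow> bool" where
  "q_weight_map scale d q X F \<longleftrightarrow>
     Vector_Spaces.linear scale scale F \<and>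
     (\<forall>i\<le>d. \<forall>v\<in>X i. F v = scale (q powi (int d - 2 * int i)) v)"

text \<open>
  Here \<^const>\<open>inv\<close> is the inverse in \<open>End(V)\<close>: in the intended situation \<open>K\<close> and
  \<open>a I - a\<^sup>-\<^sup>1 B K\<^sup>-\<^sup>1\<close> are bijective.
\<close>
definition psi_map ::
    "('a::field \<Rightarrow> 'b::ab_group_add \<Rightarrow> 'b) \<Rightarrow> 'a \<Rightarrow> 'a \<Rightarrow> ('b \<Rightarrow> 'b) \<Rightarrow> ('b \<Rightarrow> 'b) \<Rightarrow> 'b \<Rightarrow> 'b" where
  "psi_map scale q a K B =
     (\<lambda>v. v - B (inv K v)) \<circ>
     inv (\<lambda>v. scale q (scale a v - scale (inverse a) (B (inv K v))))"

definition M_map ::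
    "('a::field \<Rightarrow> 'b::ab_group_add \<Rightarrow> 'b) \<Rightarrow> 'a \<Rightarrow> ('b \<Rightarrow> 'b) \<Rightarrow> ('b \<Rightarrow> 'b) \<Rightarrow> 'b \<Rightarrow> 'b" where
  "M_map scale a K B =
     (\<lambda>v. scale (inverse (a - inverse a)) (scale a (K v) - scale (inverse a) (B v)))"

definition W_space ::
    "('a::field \<Rightarrow> 'b::ab_group_add \<Rightarrow> 'b) \<Rightarrow> nat \<Rightarrow> 'a \<Rightarrow> 'a \<Rightarrow> ('b \<Rightarrow> 'b) \<Rightarrow> ('b \<Rightarrow> 'b) \<Rightarrow> nat \<Rightarrow> 'b set" where
  "W_space scale d q a K B i = eigenspace scale (M_map scale a K B) (q powi (int d - 2 * int i))"

end

theory Submission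
  imports Defs
begin

text \<open>
  Put \<open>D = K - B\<close> and \<open>m = a K - a\<^sup>-\<^sup>1 B\<close>, a scalar multiple of \<open>\<M>\<close>. Then
  \<open>\<psi> = D (q m)\<^sup>-\<^sup>1\<close>, so that \<open>\<psi>\<close> acts on \<open>W\<^sub>i\<close> as a multiple of \<open>D\<close>, and everything follows
  from \<open>m D = q\<^sup>2 D m\<close> together with \<open>D = 0\<close> on \<open>W\<^sub>0\<close>.

  The split decompositions give \<open>q K A - q\<^sup>-\<^sup>1 A K = (q - q\<^sup>-\<^sup>1) (a K\<^sup>2 + a\<^sup>-\<^sup>1 I)\<close> and
  \<open>q A\<^sup>* K - q\<^sup>-\<^sup>1 K A\<^sup>* = (q - q\<^sup>-\<^sup>1) (b K\<^sup>2 + b\<^sup>-\<^sup>1 I)\<close>, and the same for \<open>B\<close> with \<open>a\<close> and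
  \<open>a\<^sup>-\<^sup>1\<close> exchanged. With these relations the largest \<open>D\<close>- and \<open>m\<close>-invariant subspace on which
  \<open>m D = q\<^sup>2 D m\<close> holds turns out to be invariant under \<open>A\<close> and \<open>A\<^sup>*\<close>. It contains \<open>E\<^sub>0\<^sup>*V\<close>, where
  \<open>D\<close> vanishes, so it is \<open>V\<close> by irreducibility.

  Finally \<open>K\<close>, \<open>B\<close> and hence \<open>\<M>\<close> are triangular with respect to the flag
  \<open>E\<^sub>0\<^sup>*V + \<dots> + E\<^sub>i\<^sup>*V\<close> with diagonal entries \<open>q\<^sup>d\<^sup>-\<^sup>2\<^sup>i\<close>; as \<open>q\<^sup>d\<close> occurs only for \<open>i = 0\<close>, this
  gives \<open>W\<^sub>0 = E\<^sub>0\<^sup>*V\<close>. (The case \<open>i = 0\<close> needs this separate argument because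
  \<open>q\<^sup>d\<^sup>+\<^sup>2 = q\<^sup>-\<^sup>d\<close> is possible.)
\<close>

section \<open>Sums of subspaces\<close>

context vector_space
begin

lemma subspace_set_plus:
  assumes "subspace S" "subspace T"
  shows "subspace (S + T)"
proof -
  have "S + T = {x + y | x y. x \<in> S \<and> y \<in> T}"
    by (auto simp: set_plus_def)
  then show ?thesis
    using subspace_sums[OF assms] by simp
qed

lemma subspace_set_sum:
  assumes "finite J" "\<And>j. j \<in> J \<Longrightarrow> subspace (X j)"
  shows "subspace (\<Sum>j\<in>J. X j)"
  using assms
  by (induction J) (auto simp: set_zero intro: subspace_set_plus)

lemma set_plus_least:
  assumes "S \<subseteq> W" "T \<subseteq> W" "subspace W"
  shows "S + T \<subseteq> W"
  using assms by (auto simp: set_plus_def intro: subspace_add)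

lemma set_sum_least:
  assumes "finite J" "\<And>j. j \<in> J \<Longrightarrow> X j \<subseteq> W" "subspace W"
  shows "(\<Sum>j\<in>J. X j) \<subseteq> W"
  using assms(1,2)
proof (induction J)
  case (insert j J)
  then have "X j + (\<Sum>j\<in>J. X j) \<subseteq> W"
    using assms(3) by (intro set_plus_least) auto
  with insert.hyps show ?case by simp
qed (use assms(3) in \<open>simp add: set_zero subspace_0\<close>)

lemma subset_set_sum:
  assumes "finite J" "j \<in> J" "\<And>j. j \<in> J \<Longrightarrow> subspace (X j)"
  shows "X j \<subseteq> (\<Sum>j\<in>J. X j)"
proof
  fix x assume x: "x \<in> X j"
  have "0 \<in> (\<Sum>i\<in>J - {j}. X i)"
    using assms by (intro subspace_0 subspace_set_sum) auto
  with x have "x + 0 \<in> X j + (\<Sum>i\<in>J - {j}. X i)"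
    by (rule set_plus_intro)
  then show "x \<in> (\<Sum>j\<in>J. X j)"
    using assms by (simp add: sum.remove)
qed

lemma set_sum_mono2:
  assumes "finite J" "I \<subseteq> J" "\<And>j. j \<in> J \<Longrightarrow> subspace (X j)"
  shows "(\<Sum>j\<in>I. X j) \<subseteq> (\<Sum>j\<in>J. X j)"
  using assms finite_subset[OF assms(2,1)]
  by (intro set_sum_least subset_set_sum subspace_set_sum) auto

lemma subspace_linear_vimage:
  assumes "Vector_Spaces.linear scale scale f" "subspace S"
  shows "subspace {x. f x \<in> S}"
proof -
  interpret f: Vector_Spaces.linear scale scale f by fact
  show ?thesis using f.subspace_linear_preimage[OF assms(2)] .
qed

lemma linear_shift:
  assumes "Vector_Spaces.linear scale scale f"
  shows "Vector_Spaces.linear scale scale (\<lambda>x. f x - c *s x)"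
proof -
  interpret f: Vector_Spaces.linear scale scale f by fact
  show ?thesis
    by unfold_locales (simp_all add: f.add f.scale algebra_simps)
qed

lemma set_sum_linear_into:
  assumes "Vector_Spaces.linear scale scale f" "subspace W" "finite J"
    and "\<And>j x. j \<in> J \<Longrightarrow> x \<in> X j \<Longrightarrow> f x \<in> W"
    and "v \<in> (\<Sum>j\<in>J. X j)"
  shows "f v \<in> W"
  using set_sum_least[of J X "{x. f x \<in> W}"] subspace_linear_vimage[OF assms(1,2)] assms(3-5)
  by blast

lemma subspace_range:
  assumes "Vector_Spaces.linear scale scale f"
  shows "subspace (range f)"
proof -
  interpret f: Vector_Spaces.linear scale scale f by fact
  show ?thesis using f.subspace_image[OF subspace_UNIV] .
qed

text \<open>If \<open>v\<close> lies in stage \<open>Suc n\<close> of the flag, then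
  \<open>T v - c n *s v\<close>, which is \<open>(l - c n) *s v\<close>, lies in stage
  \<open>n\<close>. Division by \<open>l - c n\<close> pushes \<open>v\<close> down one stage, as
  long as \<open>c n\<close> differs from \<open>l\<close>.\<close>

lemma triangular_eigenvector:
  assumes tri: "\<And>n x. n < N \<Longrightarrow> x \<in> (\<Sum>j<Suc n. X j) \<Longrightarrow> T x - c n *s x \<in> (\<Sum>j<n. X j)"
    and sub: "\<And>n. n < N \<Longrightarrow> subspace (X n)"
    and ev: "T v = l *s v" and ne: "\<And>n. k \<le> n \<Longrightarrow> n < N \<Longrightarrow> c n \<noteq> l"
    and v: "v \<in> (\<Sum>j<N. X j)" and "k \<le> N"
  shows "v \<in> (\<Sum>j<k. X j)"
  using \<open>k \<le> N\<close>
proof (induction k rule: inc_induct)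
  case base
  show ?case by (fact v)
next
  case (step n)
  have "(l - c n) *s v \<in> (\<Sum>j<n. X j)"
    using tri[OF step.hyps(2) step.IH] by (simp add: ev scale_left_diff_distrib)
  then have "inverse (l - c n) *s ((l - c n) *s v) \<in> (\<Sum>j<n. X j)"
    by (rule subspace_scale[rotated]) (use sub step.hyps in \<open>auto intro!: subspace_set_sum\<close>)
  moreover have "l \<noteq> c n"
    using ne[OF step.hyps] by simp
  ultimately show ?case
    by simp
qed

end

section \<open>Split decompositions\<close>

text \<open>Sums of subspaces replace the idempotents. In \<open>{i - 1..min d (Suc i)}\<close>
  truncated subtraction and \<open>min\<close> build in the convention that indices outside
  \<open>{0..d}\<close> contribute zero. The axioms on \<open>X\<close> are symmetric under
  reversal, which later yields the second split decomposition.\<close>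

locale tridiagonal_system = vector_space scale
  for scale :: "'k::field \<Rightarrow> 'v::ab_group_add \<Rightarrow> 'v" (infixr "*s" 75) +
  fixes d :: nat
    and A As :: "'v \<Rightarrow> 'v"
    and X Xs :: "nat \<Rightarrow> 'v set"
    and th ths :: "nat \<Rightarrow> 'k"
  assumes linear_A: "Vector_Spaces.linear scale scale A"
    and linear_As: "Vector_Spaces.linear scale scale As"
    and subspace_X: "i \<le> d \<Longrightarrow> subspace (X i)"
    and subspace_Xs: "i \<le> d \<Longrightarrow> subspace (Xs i)"
    and A_X: "i \<le> d \<Longrightarrow> x \<in> X i \<Longrightarrow> A x = th i *s x"
    and As_Xs: "i \<le> d \<Longrightarrow> x \<in> Xs i \<Longrightarrow> As x = ths i *s x"
    and As_X: "i \<le> d \<Longrightarrow> x \<in> X i \<Longrightarrow> As x \<in> (\<Sum>j\<in>{i - 1..min d (Suc i)}. X j)"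
    and A_Xs: "i \<le> d \<Longrightarrow> x \<in> Xs i \<Longrightarrow> A x \<in> (\<Sum>j\<in>{i - 1..min d (Suc i)}. Xs j)"
    and sum_X: "(\<Sum>j\<in>{0..d}. X j) = UNIV"
    and sum_Xs: "(\<Sum>j\<in>{0..d}. Xs j) = UNIV"
    and Xs_0: "Xs 0 \<noteq> {0}"
    and inj_ths: "inj_on ths {0..d}"
    and irreducible: "subspace W \<Longrightarrow> A ` W \<subseteq> W \<Longrightarrow> As ` W \<subseteq> W \<Longrightarrow> W = {0} \<or> W = UNIV"
begin

sublocale A: Vector_Spaces.linear scale scale A by (rule linear_A)
sublocale As: Vector_Spaces.linear scale scale As by (rule linear_As)

definition U :: "nat \<Rightarrow> 'v set" where
  "U i = (\<Sum>j\<in>{0..i}. Xs j) \<inter> (\<Sum>j\<in>{i..d}. X j)"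

lemma subspace_sum_X: "J \<subseteq> {0..d} \<Longrightarrow> subspace (\<Sum>j\<in>J. X j)"
  using finite_subset[of J "{0..d}"] subspace_X by (intro subspace_set_sum) auto

lemma subspace_sum_Xs: "J \<subseteq> {0..d} \<Longrightarrow> subspace (\<Sum>j\<in>J. Xs j)"
  using finite_subset[of J "{0..d}"] subspace_Xs by (intro subspace_set_sum) auto

lemma subspace_U: "i \<le> d \<Longrightarrow> subspace (U i)"
  unfolding U_def by (intro subspace_inter subspace_sum_X subspace_sum_Xs) auto

lemma subspace_sum_U: "J \<subseteq> {0..d} \<Longrightarrow> subspace (\<Sum>j\<in>J. U j)"
  using finite_subset[of J "{0..d}"] subspace_U by (intro subspace_set_sum) auto

lemma shift_X:
  assumes "v \<in> (\<Sum>j\<in>{i..d}. X j)"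
  shows "A v - th i *s v \<in> (\<Sum>j\<in>{Suc i..d}. X j)"
proof (rule set_sum_linear_into[OF linear_shift[OF linear_A] _ _ _ assms])
  show "subspace (\<Sum>j\<in>{Suc i..d}. X j)"
    by (rule subspace_sum_X) auto
  fix j x assume j: "j \<in> {i..d}" and x: "x \<in> X j"
  show "A x - th i *s x \<in> (\<Sum>j\<in>{Suc i..d}. X j)"
  proof (cases "j = i")
    case True
    then show ?thesis using A_X[OF _ x] j subspace_0[OF subspace_sum_X[of "{Suc i..d}"]] by auto
  next
    case False
    have "A x - th i *s x = (th j - th i) *s x"
      using A_X[OF _ x] j by (simp add: scale_left_diff_distrib)
    moreover have "X j \<subseteq> (\<Sum>j\<in>{Suc i..d}. X j)"
      using j False subspace_X by (intro subset_set_sum) auto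
    ultimately show ?thesis
      using x subspace_scale[OF subspace_sum_X[of "{Suc i..d}"]] by auto
  qed
qed simp

lemma raise_Xs:
  assumes "i < d" "v \<in> (\<Sum>j\<in>{0..i}. Xs j)"
  shows "A v \<in> (\<Sum>j\<in>{0..Suc i}. Xs j)"
proof (rule set_sum_linear_into[OF linear_A _ _ _ assms(2)])
  show "subspace (\<Sum>j\<in>{0..Suc i}. Xs j)"
    using assms by (intro subspace_sum_Xs) auto
  fix j x assume j: "j \<in> {0..i}" and x: "x \<in> Xs j"
  have "(\<Sum>j\<in>{j - 1..min d (Suc j)}. Xs j) \<subseteq> (\<Sum>j\<in>{0..Suc i}. Xs j)"
    using j assms(1) subspace_Xs by (intro set_sum_mono2) auto
  then show "A x \<in> (\<Sum>j\<in>{0..Suc i}. Xs j)"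
    using A_Xs[OF _ x] j assms(1) by auto
qed simp

lemma shift_Xs:
  assumes "i \<le> d" "v \<in> (\<Sum>j<Suc i. Xs j)"
  shows "As v - ths i *s v \<in> (\<Sum>j<i. Xs j)"
proof (rule set_sum_linear_into[OF linear_shift[OF linear_As] _ _ _ assms(2)])
  have sub: "subspace (\<Sum>j<i. Xs j)"
    using assms by (intro subspace_sum_Xs) auto
  then show "subspace (\<Sum>j<i. Xs j)" .
  fix j x assume j: "j \<in> {..<Suc i}" and x: "x \<in> Xs j"
  show "As x - ths i *s x \<in> (\<Sum>j<i. Xs j)"
  proof (cases "j = i")
    case True
    then show ?thesis using As_Xs[OF _ x] assms(1) subspace_0[OF sub] by auto
  next
    case False
    have "As x - ths i *s x = (ths j - ths i) *s x"
      using As_Xs[OF _ x] j assms(1) by (simp add: scale_left_diff_distrib)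
    moreover have "Xs j \<subseteq> (\<Sum>j<i. Xs j)"
      using j False assms(1) subspace_Xs by (intro subset_set_sum) auto
    ultimately show ?thesis
      using x subspace_scale[OF sub] by auto
  qed
qed simp

lemma lower_X:
  assumes "v \<in> (\<Sum>j\<in>{i..d}. X j)"
  shows "As v \<in> (\<Sum>j\<in>{i - 1..d}. X j)"
proof (rule set_sum_linear_into[OF linear_As _ _ _ assms])
  show "subspace (\<Sum>j\<in>{i - 1..d}. X j)"
    by (intro subspace_sum_X) auto
  fix j x assume j: "j \<in> {i..d}" and x: "x \<in> X j"
  have "(\<Sum>j\<in>{j - 1..min d (Suc j)}. X j) \<subseteq> (\<Sum>j\<in>{i - 1..d}. X j)"
    using j subspace_X by (intro set_sum_mono2) auto
  then show "As x \<in> (\<Sum>j\<in>{i - 1..d}. X j)"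
    using As_X[OF _ x] j by auto
qed simp

text \<open>\<open>A - th i\<close> annihilates \<open>X i\<close>, so the sum over
  \<open>{i..d}\<close> loses its first term; tridiagonality on the \<open>Xs\<close> side raises
  the upper end of the other sum by one.\<close>

lemma raise_U:
  assumes "i < d" "u \<in> U i"
  shows "A u - th i *s u \<in> U (Suc i)"
  unfolding U_def
proof
  have u: "u \<in> (\<Sum>j\<in>{0..i}. Xs j)" "u \<in> (\<Sum>j\<in>{i..d}. X j)"
    using assms by (auto simp: U_def)
  show "A u - th i *s u \<in> (\<Sum>j\<in>{Suc i..d}. X j)"
    by (rule shift_X[OF u(2)])
  have "(\<Sum>j\<in>{0..i}. Xs j) \<subseteq> (\<Sum>j\<in>{0..Suc i}. Xs j)"
    using assms subspace_Xs by (intro set_sum_mono2) auto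
  then show "A u - th i *s u \<in> (\<Sum>j\<in>{0..Suc i}. Xs j)"
    using raise_Xs[OF assms(1) u(1)] u(1) assms(1)
    by (intro subspace_diff subspace_scale subspace_sum_Xs) auto
qed

lemma raise_U_top:
  assumes "u \<in> U d"
  shows "A u = th d *s u"
  using shift_X[of u d] assms by (simp add: U_def set_zero)

lemma lower_U:
  assumes "Suc i \<le> d" "u \<in> U (Suc i)"
  shows "As u - ths (Suc i) *s u \<in> U i"
  unfolding U_def
proof
  have u: "u \<in> (\<Sum>j<Suc (Suc i). Xs j)" "u \<in> (\<Sum>j\<in>{Suc i..d}. X j)"
    using assms by (auto simp: U_def lessThan_Suc_atMost atLeast0AtMost)
  show "As u - ths (Suc i) *s u \<in> (\<Sum>j\<in>{0..i}. Xs j)"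
    using shift_Xs[OF assms(1) u(1)] by (simp add: lessThan_Suc_atMost atLeast0AtMost)
  have "(\<Sum>j\<in>{Suc i..d}. X j) \<subseteq> (\<Sum>j\<in>{i..d}. X j)"
    using subspace_X by (intro set_sum_mono2) auto
  then show "As u - ths (Suc i) *s u \<in> (\<Sum>j\<in>{i..d}. X j)"
    using lower_X[OF u(2)] u(2)
    by (intro subspace_diff subspace_scale subspace_sum_X) auto
qed

lemma lower_U_bottom:
  assumes "u \<in> U 0"
  shows "As u = ths 0 *s u"
  using assms by (simp add: U_def As_Xs)

lemma U_0: "U 0 = Xs 0"
  using sum_X by (simp add: U_def)

text \<open>By \<open>raise_U\<close> and \<open>lower_U\<close> the sum is invariant under
  \<open>A\<close> and \<open>As\<close>. It contains the nonzero space \<open>U 0 = Xs 0\<close>,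
  so irreducibility applies.\<close>

lemma sum_U: "(\<Sum>j\<in>{0..d}. U j) = UNIV"
proof -
  let ?W = "\<Sum>j\<in>{0..d}. U j"
  have sub: "subspace ?W"
    by (rule subspace_sum_U) auto
  have in_W: "U j \<subseteq> ?W" if "j \<le> d" for j
    using that subspace_U by (intro subset_set_sum) auto
  have "A u \<in> ?W" if "j \<le> d" "u \<in> U j" for j u
  proof (cases "j = d")
    case True
    then show ?thesis
      using raise_U_top that in_W[of d] by (auto intro: subspace_scale[OF sub])
  next
    case False
    have "(A u - th j *s u) + th j *s u \<in> ?W"
      using raise_U[of j u] that False in_W[of j] in_W[of "Suc j"]
      by (intro subspace_add[OF sub] subspace_scale[OF sub]) auto
    then show ?thesis by simp
  qed
  then have 1: "A ` ?W \<subseteq> ?W"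
    using set_sum_linear_into[OF linear_A sub, of "{0..d}" U] by auto
  have "As u \<in> ?W" if "j \<le> d" "u \<in> U j" for j u
  proof (cases j)
    case 0
    then show ?thesis
      using lower_U_bottom that in_W[of 0] by (auto intro: subspace_scale[OF sub])
  next
    case (Suc i)
    have "(As u - ths j *s u) + ths j *s u \<in> ?W"
      using lower_U[of i u] that Suc in_W[of i] in_W[of j]
      by (intro subspace_add[OF sub] subspace_scale[OF sub]) auto
    then show ?thesis by simp
  qed
  then have 2: "As ` ?W \<subseteq> ?W"
    using set_sum_linear_into[OF linear_As sub, of "{0..d}" U] by auto
  show ?thesis
    using irreducible[OF sub 1 2] in_W[of 0] Xs_0 subspace_0[OF subspace_Xs[of 0]]
    by (auto simp: U_0)
qed

text \<open>Operator identities can thus be checked on each \<open>U i\<close> separately.\<close>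

lemma all_sum_U:
  assumes "Vector_Spaces.linear scale scale f" "\<And>i u. i \<le> d \<Longrightarrow> u \<in> U i \<Longrightarrow> f u = 0"
  shows "f v = 0"
  using set_sum_linear_into[OF assms(1) subspace_single_0, of "{0..d}" U v] assms(2) sum_U
  by auto

lemma shift_sum_U:
  assumes "i \<le> d" "v \<in> (\<Sum>j<Suc i. U j)"
  shows "As v - ths i *s v \<in> (\<Sum>j<i. U j)"
proof (rule set_sum_linear_into[OF linear_shift[OF linear_As] _ _ _ assms(2)])
  have sub: "subspace (\<Sum>j<i. U j)"
    using assms by (intro subspace_sum_U) auto
  then show "subspace (\<Sum>j<i. U j)" .
  have in_W: "U j \<subseteq> (\<Sum>j<i. U j)" if "j < i" for j
    using that assms subspace_U by (intro subset_set_sum) auto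
  fix j u assume j: "j \<in> {..<Suc i}" and u: "u \<in> U j"
  have low: "As u - ths j *s u \<in> (\<Sum>j<i. U j)"
  proof (cases j)
    case 0
    then show ?thesis using lower_U_bottom u subspace_0[OF sub] by simp
  next
    case (Suc n)
    then show ?thesis using lower_U[of n u] u in_W[of n] j assms(1) by auto
  qed
  show "As u - ths i *s u \<in> (\<Sum>j<i. U j)"
  proof (cases "j = i")
    case False
    have eq: "As u - ths i *s u = (As u - ths j *s u) + (ths j - ths i) *s u"
      by (simp add: algebra_simps)
    have "u \<in> (\<Sum>j<i. U j)"
      using u in_W[of j] j False by auto
    with low show ?thesis
      unfolding eq by (intro subspace_add[OF sub] subspace_scale[OF sub])
  qed (use low in simp)
qed simp

text \<open>One inclusion is built into \<open>U\<close>. The other goes by downward induction from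
  \<open>Suc d\<close>, where both sides are the whole space: \<open>As - ths n\<close> maps stage
  \<open>Suc n\<close> of the \<open>U\<close> flag into stage \<open>n\<close>, and on
  \<open>Xs j\<close> with \<open>j < n\<close> it is a nonzero scalar. Both split decompositions
  therefore induce the same flag.\<close>

lemma sum_U_eq_sum_Xs:
  assumes "n \<le> Suc d"
  shows "(\<Sum>j<n. U j) = (\<Sum>j<n. Xs j)"
proof
  show "(\<Sum>j<n. U j) \<subseteq> (\<Sum>j<n. Xs j)"
  proof (rule set_sum_least)
    show "subspace (\<Sum>j<n. Xs j)"
      using assms by (intro subspace_sum_Xs) auto
    fix j assume j: "j \<in> {..<n}"
    have "(\<Sum>j\<in>{0..j}. Xs j) \<subseteq> (\<Sum>j<n. Xs j)"
      using j assms subspace_Xs by (intro set_sum_mono2) auto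
    then show "U j \<subseteq> (\<Sum>j<n. Xs j)" by (auto simp: U_def)
  qed simp
  show "(\<Sum>j<n. Xs j) \<subseteq> (\<Sum>j<n. U j)"
    using assms
  proof (induction n rule: inc_induct)
    case base
    then show ?case
      using sum_U by (simp add: lessThan_Suc_atMost atLeast0AtMost)
  next
    case (step n)
    have sub: "subspace (\<Sum>j<n. U j)"
      using step.hyps by (intro subspace_sum_U) auto
    show ?case
    proof (rule set_sum_least[OF _ _ sub])
      fix j assume j: "j \<in> {..<n}"
      show "Xs j \<subseteq> (\<Sum>j<n. U j)"
      proof
        fix x assume x: "x \<in> Xs j"
        have "Xs j \<subseteq> (\<Sum>j<Suc n. Xs j)"
          using j step.hyps subspace_Xs by (intro subset_set_sum) auto
        then have "As x - ths n *s x \<in> (\<Sum>j<n. U j)"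
          using x step by (intro shift_sum_U) auto
        then have "(ths j - ths n) *s x \<in> (\<Sum>j<n. U j)"
          using As_Xs[OF _ x] j step.hyps by (simp add: scale_left_diff_distrib)
        then have "inverse (ths j - ths n) *s ((ths j - ths n) *s x) \<in> (\<Sum>j<n. U j)"
          by (rule subspace_scale[OF sub])
        moreover have "ths j \<noteq> ths n"
          using inj_onD[OF inj_ths, of j n] j step.hyps by auto
        ultimately show "x \<in> (\<Sum>j<n. U j)" by simp
      qed
    qed simp
  qed
qed

text \<open>\<open>Q\<close> and \<open>k i\<close> will be q^2 and q^(d-2i). The calculations rest
  on the ratio of consecutive weights.\<close>

context
  fixes K :: "'v \<Rightarrow> 'v" and k :: "nat \<Rightarrow> 'k" and Q :: 'k
  assumes linear_K: "Vector_Spaces.linear scale scale K"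
    and K_U: "\<And>i u. i \<le> d \<Longrightarrow> u \<in> U i \<Longrightarrow> K u = k i *s u"
    and k_nz: "\<And>i. k i \<noteq> 0"
    and k_Suc: "\<And>i. Q * k (Suc i) = k i"
begin

interpretation K: Vector_Spaces.linear scale scale K by (rule linear_K)

lemma weight_map_shift:
  assumes "i \<le> d" "v \<in> (\<Sum>j<Suc i. Xs j)"
  shows "K v - k i *s v \<in> (\<Sum>j<i. Xs j)"
proof -
  have sub: "subspace (\<Sum>j<i. U j)"
    using assms by (intro subspace_sum_U) auto
  have "v \<in> (\<Sum>j<Suc i. U j)"
    using assms sum_U_eq_sum_Xs[of "Suc i"] by simp
  then have "K v - k i *s v \<in> (\<Sum>j<i. U j)"
  proof (rule set_sum_linear_into[OF linear_shift[OF linear_K] sub, rotated 2])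
    fix j u assume j: "j \<in> {..<Suc i}" and u: "u \<in> U j"
    show "K u - k i *s u \<in> (\<Sum>j<i. U j)"
    proof (cases "j = i")
      case True
      then show ?thesis using K_U[OF _ u] assms(1) subspace_0[OF sub] by simp
    next
      case False
      have "K u - k i *s u = (k j - k i) *s u"
        using K_U[OF _ u] j assms(1) by (simp add: scale_left_diff_distrib)
      moreover have "U j \<subseteq> (\<Sum>j<i. U j)"
        using j False assms(1) subspace_U by (intro subset_set_sum) auto
      ultimately show ?thesis
        using u subspace_scale[OF sub] by auto
    qed
  qed simp
  then show ?thesis
    using assms sum_U_eq_sum_Xs[of i] by simp
qed

text \<open>On \<open>U i\<close> write \<open>A u\<close> as \<open>th i *s u + w\<close> with
  \<open>w\<close> in \<open>U (Suc i)\<close>. As \<open>Q * k (Suc i) = k i\<close>, the terms in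
  \<open>w\<close> cancel, and the form of \<open>th i\<close> settles the coefficient of
  \<open>u\<close>. The scalars \<open>c\<close> and \<open>c'\<close> stay general because they are
  exchanged between \<open>K\<close> and \<open>B\<close>.\<close>

lemma weight_map_A:
  assumes th: "\<And>i. i \<le> d \<Longrightarrow> th i = c * k i + c' * inverse (k i)"
  shows "Q *s K (A v) = A (K v) + (Q - 1) *s (c *s K (K v) + c' *s v)"
proof -
  let ?f = "\<lambda>v. Q *s K (A v) - (A (K v) + (Q - 1) *s (c *s K (K v) + c' *s v))"
  have "Vector_Spaces.linear scale scale ?f"
    by unfold_locales (simp_all add: K.add K.scale A.add A.scale algebra_simps)
  moreover have "?f u = 0" if i: "i \<le> d" and u: "u \<in> U i" for i u
  proof -
    define w where "w = A u - th i *s u"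
    have A: "A u = th i *s u + w" by (simp add: w_def)
    have w: "Q *s K w = k i *s w"
    \<comment> \<open>There is no \<open>U (Suc d)\<close> to land in, but at the top index
      \<open>w\<close> is 0.\<close>
    proof (cases "i = d")
      case True
      then show ?thesis using raise_U_top u by (simp add: w_def)
    next
      case False
      then have "K w = k (Suc i) *s w"
        using raise_U i u by (intro K_U) (auto simp: w_def)
      then show ?thesis by (simp add: k_Suc)
    qed
    have "Q *s K (A u) = (Q * th i * k i) *s u + k i *s w"
      using w by (simp add: A K.add K.scale K_U[OF i u] algebra_simps)
    moreover have "A (K u) = (k i * th i) *s u + k i *s w"
      by (simp add: K_U[OF i u] A.scale A algebra_simps)
    moreover have "K (K u) = (k i * k i) *s u"
      by (simp add: K_U[OF i u] K.scale)
    ultimately have "?f u = (Q * th i * k i - k i * th i - (Q - 1) * (c * (k i * k i) + c')) *s u"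
      by (simp add: scale_left_diff_distrib scale_left_distrib scale_right_distrib distrib_left)
    also have "Q * th i * k i - k i * th i - (Q - 1) * (c * (k i * k i) + c') = 0"
      using k_nz[of i] by (simp add: th[OF i] field_simps)
    finally show ?thesis by simp
  qed
  ultimately have "?f v = 0" by (rule all_sum_U)
  then show ?thesis by simp
qed

text \<open>As for \<open>A\<close>, except that \<open>As\<close> lowers the index:
  \<open>K\<close> acts on the extra term as \<open>Q * k i\<close>, so the factor \<open>Q\<close>
  sits on the other side.\<close>

lemma weight_map_As:
  assumes ths: "\<And>i. i \<le> d \<Longrightarrow> ths i = c * k i + c' * inverse (k i)"
  shows "K (As v) = Q *s As (K v) - (Q - 1) *s (c *s K (K v) + c' *s v)"
proof -
  let ?f = "\<lambda>v. K (As v) - (Q *s As (K v) - (Q - 1) *s (c *s K (K v) + c' *s v))"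
  have "Vector_Spaces.linear scale scale ?f"
    by unfold_locales (simp_all add: K.add K.scale As.add As.scale algebra_simps)
  moreover have "?f u = 0" if i: "i \<le> d" and u: "u \<in> U i" for i u
  proof -
    define w where "w = As u - ths i *s u"
    have As: "As u = ths i *s u + w" by (simp add: w_def)
    have w: "K w = (Q * k i) *s w"
    proof (cases i)
      case 0
      then show ?thesis using lower_U_bottom u by (simp add: w_def)
    next
      case (Suc n)
      then have "K w = k n *s w"
        using lower_U i u by (intro K_U) (auto simp: w_def)
      then show ?thesis using k_Suc[of n] Suc by simp
    qed
    have "K (As u) = (ths i * k i) *s u + (Q * k i) *s w"
      using w by (simp add: As K.add K.scale K_U[OF i u])
    moreover have "Q *s As (K u) = (Q * k i * ths i) *s u + (Q * k i) *s w"
      by (simp add: K_U[OF i u] As.scale As scale_right_distrib mult.assoc)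
    moreover have "K (K u) = (k i * k i) *s u"
      by (simp add: K_U[OF i u] K.scale)
    ultimately have "?f u = (ths i * k i - Q * k i * ths i + (Q - 1) * (c * (k i * k i) + c')) *s u"
      by (simp add: scale_left_diff_distrib scale_left_distrib scale_right_distrib distrib_left)
    also have "ths i * k i - Q * k i * ths i + (Q - 1) * (c * (k i * k i) + c') = 0"
      using k_nz[of i] by (simp add: ths[OF i] field_simps)
    finally show ?thesis by simp
  qed
  ultimately have "?f v = 0" by (rule all_sum_U)
  then show ?thesis by simp
qed

end

end

section \<open>The relation \<open>m D = q\<^sup>2 D m\<close>\<close>

locale operator_pair = vector_space scale
  for scale :: "'k::field \<Rightarrow> 'v::ab_group_add \<Rightarrow> 'v" (infixr "*s" 75) +
  fixes D m :: "'v \<Rightarrow> 'v" and Q :: 'k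
  assumes linear_D: "Vector_Spaces.linear scale scale D"
    and linear_m: "Vector_Spaces.linear scale scale m"
    and Q_nz: "Q \<noteq> 0"
begin

sublocale D: Vector_Spaces.linear scale scale D by (rule linear_D)
sublocale m: Vector_Spaces.linear scale scale m by (rule linear_m)

text \<open>Moving \<open>A\<close> to the left of \<open>D\<close> and \<open>m\<close> on both
  sides leaves words in \<open>D\<close> and \<open>m\<close> applied to \<open>s\<close>, where the
  relation is already known. Multiplying by \<open>Q\<close> twice allows \<open>DA\<close> and
  \<open>mA\<close> to be used without inverses.\<close>

lemma q_commute_A:
  assumes "Vector_Spaces.linear scale scale A"
    and DA: "\<And>v. Q *s D (A v) = A (D v) + r *s (m (m v) - D (D v) - (e * e) *s v)"
    and mA: "\<And>v. Q *s m (A v) = A (m v) + r *s (h *s m (m v) - m (D v) - D (m v))"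
    and comm: "\<And>s. s \<in> S \<Longrightarrow> m (D s) = Q *s D (m s)"
    and inv: "\<And>s. s \<in> S \<Longrightarrow> m s \<in> S" "\<And>s. s \<in> S \<Longrightarrow> D s \<in> S"
    and "s \<in> S"
  shows "m (D (A s)) = Q *s D (m (A s))"
proof -
  interpret A: Vector_Spaces.linear scale scale A by fact
  note lin = A.add A.diff A.scale D.add D.diff D.scale m.add m.diff m.scale
  have "Q *s (Q *s m (D (A s))) = Q *s m (Q *s D (A s))"
    by (simp add: m.scale)
  also have "\<dots> = A (m (D s)) + r *s (h *s m (m (D s)) - m (D (D s)) - D (m (D s)))
      + (Q * r) *s m (m (m s) - D (D s) - (e * e) *s s)"
    by (simp add: DA m.add m.scale scale_right_distrib mA)
  finally have mDA: "Q *s (Q *s m (D (A s))) = \<dots>" .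
  have "Q *s (Q *s D (m (A s))) = Q *s D (Q *s m (A s))"
    by (simp add: D.scale)
  also have "\<dots> = A (D (m s)) + r *s (m (m (m s)) - D (D (m s)) - (e * e) *s m s)
      + (Q * r) *s D (h *s m (m s) - m (D s) - D (m s))"
    by (simp add: mA D.add D.scale scale_right_distrib DA)
  finally have DmA: "Q *s (Q *s D (m (A s))) = \<dots>" .
  \<comment> \<open>Using \<open>comm\<close> at \<open>s\<close>, \<open>D s\<close> and
    \<open>m s\<close>, every word is sorted with \<open>D\<close> to the left of \<open>m\<close>;
    then all terms cancel.\<close>
  have "Q *s (Q *s m (D (A s))) = Q *s (Q *s (Q *s D (m (A s))))"
    unfolding mDA DmA
    using \<open>s \<in> S\<close> by (simp add: lin comm inv algebra_simps)
  then have "(Q * Q) *s m (D (A s)) = (Q * Q) *s (Q *s D (m (A s)))"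
    by (simp add: mult.assoc)
  then show ?thesis
    unfolding scale_cancel_left using Q_nz by simp
qed

lemma q_commute_As:
  assumes "Vector_Spaces.linear scale scale As"
    and DA: "\<And>v. D (As v) = Q *s As (D v) - r *s (m (D v) + D (m v) - h *s D (D v))"
    and mA: "\<And>v. m (As v) = Q *s As (m v) - r *s (m (m v) - D (D v)) - t *s v"
    and comm: "\<And>s. s \<in> S \<Longrightarrow> m (D s) = Q *s D (m s)"
    and inv: "\<And>s. s \<in> S \<Longrightarrow> m s \<in> S" "\<And>s. s \<in> S \<Longrightarrow> D s \<in> S"
    and "s \<in> S"
  shows "m (D (As s)) = Q *s D (m (As s))"
proof -
  interpret As: Vector_Spaces.linear scale scale As by fact
  note lin = As.add As.diff As.scale D.add D.diff D.scale m.add m.diff m.scale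
  show ?thesis
    using \<open>s \<in> S\<close> by (simp add: DA mA lin comm inv algebra_simps)
qed

definition q_commuting :: "'v set \<Rightarrow> bool" where
  "q_commuting S \<longleftrightarrow> subspace S \<and> D ` S \<subseteq> S \<and> m ` S \<subseteq> S \<and> (\<forall>s\<in>S. m (D s) = Q *s D (m s))"

text \<open>
  This is itself \<^const>\<open>q_commuting\<close>, hence the largest such subspace; its maximality is what
  makes it invariant under \<open>A\<close> and \<open>A\<^sup>*\<close>, because \<open>N + A N\<close> is again \<^const>\<open>q_commuting\<close>.
\<close>

definition q_commuting_part :: "'v set" where
  "q_commuting_part = span (\<Union> {S. q_commuting S})"

lemma q_commuting_subset: "q_commuting S \<Longrightarrow> S \<subseteq> q_commuting_part"
  unfolding q_commuting_part_def by (auto intro: span_base)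

lemma q_commuting_part: "q_commuting q_commuting_part"
proof -
  let ?N = "\<Union> {S. q_commuting S}"
  have "D ` ?N \<subseteq> ?N" "m ` ?N \<subseteq> ?N"
    by (auto simp: q_commuting_def)
  then have "D ` span ?N \<subseteq> span ?N" "m ` span ?N \<subseteq> span ?N"
    by (simp_all add: span_mono flip: D.span_image m.span_image)
  moreover have "m (D s) = Q *s D (m s)" if "s \<in> span ?N" for s
    using that
  proof (induction s rule: span_induct_alt)
    case base
    show ?case by (simp add: D.zero m.zero)
  next
    case (step c x y)
    then have "m (D x) = Q *s D (m x)" by (auto simp: q_commuting_def)
    with step show ?case by (simp add: D.add D.scale m.add m.scale algebra_simps)
  qed
  ultimately show ?thesis
    by (simp add: q_commuting_def q_commuting_part_def)
qed

lemma q_commuting_partD: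
  "subspace q_commuting_part"
  "s \<in> q_commuting_part \<Longrightarrow> D s \<in> q_commuting_part"
  "s \<in> q_commuting_part \<Longrightarrow> m s \<in> q_commuting_part"
  "s \<in> q_commuting_part \<Longrightarrow> m (D s) = Q *s D (m s)"
  using q_commuting_part by (auto simp: q_commuting_def)

text \<open>The witnesses \<open>x\<close> and \<open>y\<close> in \<open>DT\<close> and
  \<open>mT\<close> express membership in the sum of the subspace and its image under
  \<open>T\<close>; maximality absorbs that sum.\<close>

lemma q_commuting_part_invariant:
  assumes "Vector_Spaces.linear scale scale T"
    and DT: "\<And>s. s \<in> q_commuting_part \<Longrightarrow>
      \<exists>x\<in>q_commuting_part. \<exists>y\<in>q_commuting_part. D (T s) = x + T y"
    and mT: "\<And>s. s \<in> q_commuting_part \<Longrightarrow>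
      \<exists>x\<in>q_commuting_part. \<exists>y\<in>q_commuting_part. m (T s) = x + T y"
    and comm: "\<And>s. s \<in> q_commuting_part \<Longrightarrow> m (D (T s)) = Q *s D (m (T s))"
  shows "T ` q_commuting_part \<subseteq> q_commuting_part"
proof -
  interpret T: Vector_Spaces.linear scale scale T by fact
  let ?N = q_commuting_part
  let ?S = "?N + T ` ?N"
  have sub: "subspace ?S"
    using q_commuting_partD(1) by (intro subspace_set_plus T.subspace_image)
  have in_S: "x + T y \<in> ?S" if "x \<in> ?N" "y \<in> ?N" for x y
    using that by auto
  have le: "?N \<subseteq> ?S" "T ` ?N \<subseteq> ?S"
    using in_S[of _ 0] in_S[of 0] subspace_0[OF q_commuting_partD(1)] by (auto simp: T.zero)
  have split: "\<exists>x\<in>?N. \<exists>y\<in>?N. s = x + T y" if "s \<in> ?S" for s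
    using that by (auto simp: set_plus_def)
  have "D s \<in> ?S" if "s \<in> ?S" for s
  proof -
    obtain x y where "x \<in> ?N" "y \<in> ?N" "s = x + T y"
      using split \<open>s \<in> ?S\<close> by blast
    then show ?thesis
      using DT[of y] q_commuting_partD(2)[of x] in_S le by (auto simp: D.add intro!: subspace_add[OF sub])
  qed
  moreover have "m s \<in> ?S" if "s \<in> ?S" for s
  proof -
    obtain x y where "x \<in> ?N" "y \<in> ?N" "s = x + T y"
      using split \<open>s \<in> ?S\<close> by blast
    then show ?thesis
      using mT[of y] q_commuting_partD(3)[of x] in_S le by (auto simp: m.add intro!: subspace_add[OF sub])
  qed
  moreover have "m (D s) = Q *s D (m s)" if "s \<in> ?S" for s
  proof -
    obtain x y where "x \<in> ?N" "y \<in> ?N" "s = x + T y"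
      using split \<open>s \<in> ?S\<close> by blast
    then show ?thesis
      using q_commuting_partD(4) comm by (simp add: D.add m.add scale_right_distrib)
  qed
  ultimately have "q_commuting ?S"
    using sub by (auto simp: q_commuting_def)
  then show ?thesis
    using q_commuting_subset le by blast
qed

text \<open>Moving \<open>A\<close> past \<open>D\<close> or \<open>m\<close> costs only terms of
  degree at most two in \<open>D\<close> and \<open>m\<close>, and these preserve
  \<open>q_commuting_part\<close>.\<close>

lemma q_commuting_part_A:
  assumes "Vector_Spaces.linear scale scale A"
    and DA: "\<And>v. Q *s D (A v) = A (D v) + r *s (m (m v) - D (D v) - (e * e) *s v)"
    and mA: "\<And>v. Q *s m (A v) = A (m v) + r *s (h *s m (m v) - m (D v) - D (m v))"
  shows "A ` q_commuting_part \<subseteq> q_commuting_part"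
proof -
  interpret A: Vector_Spaces.linear scale scale A by fact
  note closed = subspace_add subspace_diff subspace_scale q_commuting_partD(1-3)
  show ?thesis
  proof (rule q_commuting_part_invariant[OF assms(1)])
    fix s assume s: "s \<in> q_commuting_part"
    have "D (A s) = inverse Q *s (Q *s D (A s))"
      using Q_nz by simp
    then have "D (A s) = inverse Q *s (r *s (m (m s) - D (D s) - (e * e) *s s)) + A (inverse Q *s D s)"
      unfolding DA by (simp add: A.scale scale_right_distrib add.commute)
    then show "\<exists>x\<in>q_commuting_part. \<exists>y\<in>q_commuting_part. D (A s) = x + A y"
      using s by (blast intro: closed)
    have "m (A s) = inverse Q *s (Q *s m (A s))"
      using Q_nz by simp
    then have "m (A s) = inverse Q *s (r *s (h *s m (m s) - m (D s) - D (m s))) + A (inverse Q *s m s)"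
      unfolding mA by (simp add: A.scale scale_right_distrib add.commute)
    then show "\<exists>x\<in>q_commuting_part. \<exists>y\<in>q_commuting_part. m (A s) = x + A y"
      using s by (blast intro: closed)
    show "m (D (A s)) = Q *s D (m (A s))"
      using q_commuting_partD s by (intro q_commute_A[OF assms, of q_commuting_part])
  qed
qed

lemma q_commuting_part_As:
  assumes "Vector_Spaces.linear scale scale As"
    and DA: "\<And>v. D (As v) = Q *s As (D v) - r *s (m (D v) + D (m v) - h *s D (D v))"
    and mA: "\<And>v. m (As v) = Q *s As (m v) - r *s (m (m v) - D (D v)) - t *s v"
  shows "As ` q_commuting_part \<subseteq> q_commuting_part"
proof -
  interpret As: Vector_Spaces.linear scale scale As by fact
  note closed = subspace_add subspace_diff subspace_scale q_commuting_partD(1-3) subspace_neg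
  show ?thesis
  proof (rule q_commuting_part_invariant[OF assms(1)])
    fix s assume s: "s \<in> q_commuting_part"
    have "D (As s) = - (r *s (m (D s) + D (m s) - h *s D (D s))) + As (Q *s D s)"
      unfolding DA by (simp add: As.scale)
    then show "\<exists>x\<in>q_commuting_part. \<exists>y\<in>q_commuting_part. D (As s) = x + As y"
      using s by (blast intro: closed)
    have "m (As s) = - (r *s (m (m s) - D (D s)) + t *s s) + As (Q *s m s)"
      unfolding mA by (simp add: As.scale)
    then show "\<exists>x\<in>q_commuting_part. \<exists>y\<in>q_commuting_part. m (As s) = x + As y"
      using s by (blast intro: closed)
    show "m (D (As s)) = Q *s D (m (As s))"
      using q_commuting_partD s by (intro q_commute_As[OF assms, of q_commuting_part])
  qed
qed

end

text \<open>Reversing \<open>X\<close> alone turns \<open>U\<close> into the second split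
  decomposition, so every result about \<open>U\<close> and \<open>K\<close> has a counterpart for
  \<open>B\<close>. The flag built from \<open>Xs\<close> is unchanged.\<close>

lemma (in tridiagonal_system) reverse:
  "tridiagonal_system scale d A As (\<lambda>i. X (d - i)) Xs (\<lambda>i. th (d - i)) ths"
proof -
  have rev: "(\<Sum>j\<in>{l..n}. X (d - j)) = (\<Sum>j\<in>{d - n..d - l}. X j)" if "l \<le> d" "n \<le> d" for l n
    using that by (intro sum.reindex_bij_witness[of _ "\<lambda>j. d - j" "\<lambda>j. d - j"]) auto
  show ?thesis
  proof (intro tridiagonal_system.intro tridiagonal_system_axioms.intro vector_space_axioms)
    show "(\<Sum>j\<in>{0..d}. X (d - j)) = UNIV"
      using rev[of 0 d] sum_X by simp
    fix i x assume i: "i \<le> d" and x: "x \<in> X (d - i)"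
    have "{d - i - 1..min d (Suc (d - i))} = {d - min d (Suc i)..d - (i - 1)}"
      using i by auto
    then have "(\<Sum>j\<in>{i - 1..min d (Suc i)}. X (d - j)) = (\<Sum>j\<in>{d - i - 1..min d (Suc (d - i))}. X j)"
      unfolding \<open>{d - i - 1..min d (Suc (d - i))} = _\<close> by (intro rev) (use i in auto)
    then show "As x \<in> (\<Sum>j\<in>{i - 1..min d (Suc i)}. X (d - j))"
      using As_X[OF _ x] by simp
  qed (simp_all add: linear_A linear_As subspace_X subspace_Xs A_X As_Xs A_Xs[unfolded One_nat_def]
      sum_Xs Xs_0 inj_ths irreducible)
qed

section \<open>From TD systems to \<open>tridiagonal_system\<close>\<close>

context vector_space
begin

lemma zero_ext_neighbours_subset:
  assumes "\<And>i. i \<le> d \<Longrightarrow> subspace (X i)" "i \<le> d"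
  shows "zero_ext d X (int i - 1) + zero_ext d X (int i) + zero_ext d X (int i + 1)
    \<subseteq> (\<Sum>j\<in>{i - 1..min d (Suc i)}. X j)"
proof -
  let ?W = "\<Sum>j\<in>{i - 1..min d (Suc i)}. X j"
  have sub: "subspace ?W"
    using assms by (intro subspace_set_sum) auto
  have "zero_ext d X j \<subseteq> ?W" if "int i - 1 \<le> j" "j \<le> int i + 1" for j
  proof (cases "0 \<le> j \<and> j \<le> int d")
    case True
    then have "X (nat j) \<subseteq> ?W"
      using assms that by (intro subset_set_sum) auto
    with True show ?thesis by (simp add: zero_ext_def)
  next
    case False
    then show ?thesis using subspace_0[OF sub] by (auto simp: zero_ext_def)
  qed
  then show ?thesis
    by (intro set_plus_least sub) auto
qed

lemma standard_ordering_eigenspace: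
  assumes "Vector_Spaces.linear scale scale f" "standard_ordering scale f g d X"
    and "\<And>i v. i \<le> d \<Longrightarrow> v \<in> X i \<Longrightarrow> f v = th i *s v" and "i \<le> d"
  shows "X i = eigenspace scale f (th i)" "X i \<noteq> {0}"
proof -
  interpret f: Vector_Spaces.linear scale scale f by fact
  have "X i \<in> eigenspaces scale f"
    using assms by (auto simp: standard_ordering_def bij_betw_def)
  then obtain l where l: "X i = eigenspace scale f l" and nz: "X i \<noteq> {0}"
    by (auto simp: eigenspaces_def)
  have "0 \<in> X i"
    by (simp add: l eigenspace_def f.zero)
  with nz obtain v where v: "v \<in> X i" "v \<noteq> 0" by blast
  then have "l *s v = th i *s v"
    using l assms(3)[OF \<open>i \<le> d\<close> v(1)] by (simp add: eigenspace_def)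
  with v have "l = th i" by simp
  with l nz show "X i = eigenspace scale f (th i)" "X i \<noteq> {0}" by auto
qed

text \<open>Equal scalars would give equal eigenspaces, whereas an ordering has no
  repetition.\<close>

lemma standard_ordering_inj:
  assumes "Vector_Spaces.linear scale scale f" "standard_ordering scale f g d X"
    and "\<And>i v. i \<le> d \<Longrightarrow> v \<in> X i \<Longrightarrow> f v = th i *s v"
  shows "inj_on th {0..d}"
proof (rule inj_onI)
  have eig: "X i = eigenspace scale f (th i)" if "i \<le> d" for i
    by (rule standard_ordering_eigenspace(1)[OF assms that])
  fix i j assume "i \<in> {0..d}" "j \<in> {0..d}" "th i = th j"
  moreover from this have "X i = X j"
    using eig[of i] eig[of j] by simp
  moreover have "inj_on X {0..d}"
    using assms(2) by (auto simp: standard_ordering_def bij_betw_def)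
  ultimately show "i = j" by (auto dest: inj_onD)
qed

lemma standard_ordering_sum:
  assumes "standard_ordering scale f g d X" "diagonalizable scale f"
    and "\<And>i. i \<le> d \<Longrightarrow> subspace (X i)"
  shows "(\<Sum>j\<in>{0..d}. X j) = UNIV"
proof -
  have sub: "subspace (\<Sum>j\<in>{0..d}. X j)"
    using assms by (intro subspace_set_sum) auto
  have "\<Union> (eigenspaces scale f) = (\<Union>j\<in>{0..d}. X j)"
    using assms by (auto simp: standard_ordering_def bij_betw_def)
  also have "\<dots> \<subseteq> (\<Sum>j\<in>{0..d}. X j)"
    using assms by (intro UN_least subset_set_sum) auto
  finally have "span (\<Union> (eigenspaces scale f)) \<subseteq> (\<Sum>j\<in>{0..d}. X j)"
    by (intro span_minimal sub)
  then show ?thesis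
    using assms by (auto simp: diagonalizable_def)
qed

lemma td_system_tridiagonal:
  assumes td: "td_system scale d A E As Es"
    and A: "\<And>i v. i \<le> d \<Longrightarrow> v \<in> range (E i) \<Longrightarrow> A v = th i *s v"
    and As: "\<And>i v. i \<le> d \<Longrightarrow> v \<in> range (Es i) \<Longrightarrow> As v = ths i *s v"
  shows "tridiagonal_system scale d A As (\<lambda>i. range (E i)) (\<lambda>i. range (Es i)) th ths"
proof -
  have lin: "Vector_Spaces.linear scale scale A" "Vector_Spaces.linear scale scale As"
    and diag: "diagonalizable scale A" "diagonalizable scale As"
    and ord: "standard_ordering scale A As d (\<lambda>i. range (E i))"
      "standard_ordering scale As A d (\<lambda>i. range (Es i))"
    using td by (auto simp: td_system_def td_pair_def)
  have "Vector_Spaces.linear scale scale (E i)" "Vector_Spaces.linear scale scale (Es i)" if "i \<le> d" for i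
    using td that unfolding td_system_def primitive_idempotent_def by blast+
  then have sub: "subspace (range (E i))" "subspace (range (Es i))" if "i \<le> d" for i
    using that by (blast intro: subspace_range)+
  show ?thesis
  proof (intro tridiagonal_system.intro tridiagonal_system_axioms.intro vector_space_axioms)
    show "inj_on ths {0..d}"
      by (rule standard_ordering_inj[OF lin(2) ord(2) As])
    show "range (Es 0) \<noteq> {0}"
      using standard_ordering_eigenspace(2)[OF lin(2) ord(2) As le0] by simp
    show "(\<Sum>j\<in>{0..d}. range (E j)) = UNIV" "(\<Sum>j\<in>{0..d}. range (Es j)) = UNIV"
      using standard_ordering_sum ord diag sub by auto
    show "As x \<in> (\<Sum>j\<in>{i - 1..min d (Suc i)}. range (E j))" if "i \<le> d" "x \<in> range (E i)" for i x
      using ord(1) zero_ext_neighbours_subset[of d "\<lambda>i. range (E i)" i] sub that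
      by (fastforce simp: standard_ordering_def)
    show "A x \<in> (\<Sum>j\<in>{i - 1..min d (Suc i)}. range (Es j))" if "i \<le> d" "x \<in> range (Es i)" for i x
      using ord(2) zero_ext_neighbours_subset[of d "\<lambda>i. range (Es i)" i] sub that
      by (fastforce simp: standard_ordering_def)
    show "W = {0} \<or> W = UNIV" if "subspace W" "A ` W \<subseteq> W" "As ` W \<subseteq> W" for W
      using td that unfolding td_system_def td_pair_def by blast
  qed (use lin sub A As in auto)
qed

end

section \<open>The maps \<open>K\<close>, \<open>B\<close> and \<open>M_map\<close> in the q-Racah
  case\<close>

context tridiagonal_system
begin

context
  fixes a b q :: 'k and K B :: "'v \<Rightarrow> 'v"
  assumes nz: "q \<noteq> 0" "a \<noteq> 0" "a \<noteq> inverse a"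
    and th: "th = (\<lambda>i. a * q powi (int d - 2 * int i) + inverse a * q powi (2 * int i - int d))"
    and ths: "ths = (\<lambda>i. b * q powi (int d - 2 * int i) + inverse b * q powi (2 * int i - int d))"
    and linear_K: "Vector_Spaces.linear scale scale K"
    and K_U: "\<And>i u. i \<le> d \<Longrightarrow> u \<in> U i \<Longrightarrow> K u = q powi (int d - 2 * int i) *s u"
    and linear_B: "Vector_Spaces.linear scale scale B"
    and B_U: "\<And>i u. i \<le> d \<Longrightarrow> u \<in> tridiagonal_system.U d (\<lambda>i. X (d - i)) Xs i \<Longrightarrow>
      B u = q powi (int d - 2 * int i) *s u"
begin

interpretation K: Vector_Spaces.linear scale scale K by (rule linear_K)
interpretation B: Vector_Spaces.linear scale scale B by (rule linear_B)

interpretation down: tridiagonal_system scale d A As "\<lambda>i. X (d - i)" Xs "\<lambda>i. th (d - i)" ths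
  by (rule reverse)

private definition k :: "nat \<Rightarrow> 'k" where "k i = q powi (int d - 2 * int i)"

private lemma k_nz: "k i \<noteq> 0"
  using nz by (simp add: k_def)

private lemma k_Suc: "q * q * k (Suc i) = k i"
proof -
  have "q * q * k (Suc i) = q powi 2 * q powi (int d - 2 * int (Suc i))"
    by (simp add: k_def power2_eq_square)
  also have "\<dots> = q powi (2 + (int d - 2 * int (Suc i)))"
    by (rule power_int_add[symmetric]) (simp add: nz)
  also have "2 + (int d - 2 * int (Suc i)) = int d - 2 * int i"
    by simp
  finally show ?thesis by (simp add: k_def)
qed

private lemma inverse_k: "inverse (k i) = q powi (2 * int i - int d)"
  by (simp add: k_def flip: power_int_minus)

private lemma th_k: "th i = a * k i + inverse a * inverse (k i)"
  unfolding inverse_k by (simp add: th k_def)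

private lemma ths_k: "ths i = b * k i + inverse b * inverse (k i)"
  unfolding inverse_k by (simp add: ths k_def)

text \<open>Reversing the index inverts q^(d-2i), so \<open>a\<close> and \<open>inverse a\<close>
  trade places in the relation between \<open>B\<close> and \<open>A\<close>.\<close>

private lemma th_k_down:
  assumes "i \<le> d"
  shows "th (d - i) = inverse a * k i + a * inverse (k i)"
proof -
  have "int d - 2 * int (d - i) = 2 * int i - int d" "2 * int (d - i) - int d = int d - 2 * int i"
    using assms by auto
  then show ?thesis
    unfolding inverse_k by (simp add: th k_def)
qed

private lemmas KA =
  weight_map_A[where K = K and k = k and Q = "q * q", OF linear_K K_U[folded k_def] k_nz k_Suc th_k]
private lemmas BA =
  down.weight_map_A[where K = B and k = k and Q = "q * q", OF linear_B B_U[folded k_def] k_nz k_Suc th_k_down]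
private lemmas KAs =
  weight_map_As[where K = K and k = k and Q = "q * q", OF linear_K K_U[folded k_def] k_nz k_Suc ths_k]
private lemmas BAs =
  down.weight_map_As[where K = B and k = k and Q = "q * q", OF linear_B B_U[folded k_def] k_nz k_Suc ths_k]

lemma weight_map_flag:
  assumes "i \<le> d" "v \<in> (\<Sum>j<Suc i. Xs j)"
  shows "K v - q powi (int d - 2 * int i) *s v \<in> (\<Sum>j<i. Xs j)"
    and "B v - q powi (int d - 2 * int i) *s v \<in> (\<Sum>j<i. Xs j)"
  using weight_map_shift[where K = K and k = k and Q = "q * q", OF linear_K K_U[folded k_def] k_nz k_Suc assms]
    down.weight_map_shift[where K = B and k = k and Q = "q * q", OF linear_B B_U[folded k_def] k_nz k_Suc assms]
  by (simp_all add: k_def)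

lemma weight_map_bottom:
  assumes "v \<in> Xs 0"
  shows "K v = q powi int d *s v" "B v = q powi int d *s v"
  using K_U[of 0 v] B_U[of 0 v] assms by (simp_all add: U_0 down.U_0)

text \<open>The relations of \<open>K\<close> and \<open>B\<close> with \<open>A\<close> and
  \<open>As\<close> are rewritten in terms of \<open>D\<close> and \<open>m\<close>, which makes
  \<open>q_commuting_part\<close> invariant; irreducibility finishes the argument.\<close>

lemma weight_maps_q_commute:
  defines "D \<equiv> \<lambda>v. K v - B v" and "m \<equiv> \<lambda>v. a *s K v - inverse a *s B v"
  shows "m (D v) = (q * q) *s D (m v)"
proof -
  define c where "c = inverse a"
  define e where "e = a - c"
  define Q where "Q = q * q"
  have ac: "a * c = 1" "c * a = 1" and ac': "a * (c * x) = x" "c * (a * x) = x" for x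
    using nz by (simp_all add: c_def)
  have e: "e \<noteq> 0"
    using nz by (simp add: e_def c_def)
  have m_def': "m v = a *s K v - c *s B v" for v
    by (simp add: m_def c_def)
  note lin = A.add A.diff A.scale As.add As.diff As.scale K.add K.diff K.scale B.add B.diff B.scale
  have lin_D: "Vector_Spaces.linear scale scale D" and lin_m: "Vector_Spaces.linear scale scale m"
    unfolding D_def m_def by (unfold_locales; simp add: lin algebra_simps)+
  interpret operator_pair scale D m Q
    by (intro operator_pair.intro operator_pair_axioms.intro vector_space_axioms lin_D lin_m)
      (simp add: nz Q_def)
  \<comment> \<open>In these three combinations the mixed products of \<open>K\<close> and
    \<open>B\<close> cancel, because \<open>a * c = 1\<close>. What remains are the squares that
    occur in the four relations, up to the factor \<open>e\<close>.\<close>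
  have sq: "m (m v) - D (D v) = e *s (a *s K (K v) - c *s B (B v))" for v
    by (simp add: m_def' D_def e_def lin algebra_simps ac ac')
  have anti: "(a + c) *s m (m v) - m (D v) - D (m v) = e *s ((a * a) *s K (K v) - (c * c) *s B (B v))" for v
    by (simp add: m_def' D_def e_def lin algebra_simps ac ac')
  have anti': "m (D v) + D (m v) - (a + c) *s D (D v) = e *s (K (K v) - B (B v))" for v
    by (simp add: m_def' D_def e_def lin algebra_simps ac ac')
  have KA: "Q *s K (A v) = A (K v) + (Q - 1) *s (a *s K (K v) + c *s v)"
    and BA: "Q *s B (A v) = A (B v) + (Q - 1) *s (c *s B (B v) + a *s v)"
    and KAs: "K (As v) = Q *s As (K v) - (Q - 1) *s (b *s K (K v) + inverse b *s v)"
    and BAs: "B (As v) = Q *s As (B v) - (Q - 1) *s (b *s B (B v) + inverse b *s v)" for v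
    using KA[of v] BA[of v] KAs[of v] BAs[of v] by (simp_all add: Q_def c_def)
  \<comment> \<open>This absorbs the factor \<open>e\<close>; \<open>x\<close> is 1 for
    \<open>A\<close> and \<open>b\<close> for \<open>As\<close>.\<close>
  have r: "((Q - 1) * x / e) *s (e *s w) = ((Q - 1) * x) *s w" for x w
    using e by simp
  have "Q *s D (A v) = A (D v) + ((Q - 1) * 1 / e) *s (m (m v) - D (D v) - (e * e) *s v)" for v
  proof -
    have "Q *s D (A v) = Q *s K (A v) - Q *s B (A v)"
      by (simp add: D_def scale_right_diff_distrib)
    also have "\<dots> = A (D v) + ((Q - 1) * 1) *s (a *s K (K v) - c *s B (B v) - e *s v)"
      unfolding KA BA by (simp add: D_def e_def lin algebra_simps)
    also have "\<dots> = A (D v) + ((Q - 1) * 1 / e) *s (e *s (a *s K (K v) - c *s B (B v) - e *s v))"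
      unfolding r ..
    also have "e *s (a *s K (K v) - c *s B (B v) - e *s v) = m (m v) - D (D v) - (e * e) *s v"
      unfolding sq by (simp add: scale_right_diff_distrib)
    finally show ?thesis .
  qed
  moreover have "Q *s m (A v) = A (m v) + ((Q - 1) * 1 / e) *s ((a + c) *s m (m v) - m (D v) - D (m v))" for v
  proof -
    have "Q *s m (A v) = a *s (Q *s K (A v)) - c *s (Q *s B (A v))"
      by (simp add: m_def' scale_right_diff_distrib mult.commute)
    also have "\<dots> = A (m v) + ((Q - 1) * 1) *s ((a * a) *s K (K v) - (c * c) *s B (B v))"
      unfolding KA BA by (simp add: m_def' lin algebra_simps ac ac')
    finally show ?thesis
      unfolding anti r .
  qed
  ultimately have A_inv: "A ` q_commuting_part \<subseteq> q_commuting_part"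
    by (rule q_commuting_part_A[OF linear_A])
  have "D (As v) = Q *s As (D v) - ((Q - 1) * b / e) *s (m (D v) + D (m v) - (a + c) *s D (D v))" for v
    unfolding anti' r unfolding D_def KAs BAs by (simp add: lin algebra_simps)
  moreover have "m (As v) = Q *s As (m v) - ((Q - 1) * b / e) *s (m (m v) - D (D v)) - ((Q - 1) * inverse b * e) *s v" for v
    unfolding sq r unfolding m_def' KAs BAs by (simp add: lin algebra_simps e_def)
  ultimately have As_inv: "As ` q_commuting_part \<subseteq> q_commuting_part"
    by (rule q_commuting_part_As[OF linear_As])
  have sub: "subspace (Xs 0)"
    by (rule subspace_Xs) simp
  \<comment> \<open>\<open>K\<close> and \<open>B\<close> act on \<open>Xs 0\<close> by the same
    scalar q^d, so both sides of the relation vanish there.\<close>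
  have D0: "D v = 0" and m0: "m v \<in> Xs 0" if "v \<in> Xs 0" for v
    using weight_map_bottom[OF that] that
    by (auto simp: D_def m_def' simp flip: scale_left_diff_distrib intro: subspace_scale[OF sub])
  have "q_commuting (Xs 0)"
    using D0 m0 subspace_0[OF sub] sub by (auto simp: q_commuting_def m.zero)
  then have "Xs 0 \<subseteq> q_commuting_part"
    by (rule q_commuting_subset)
  then have "q_commuting_part = UNIV"
    using irreducible[OF q_commuting_partD(1) A_inv As_inv] Xs_0 subspace_0[OF sub] by auto
  then show ?thesis
    using q_commuting_partD(4) by (simp add: Q_def)
qed

text \<open>\<open>K\<close> is triangular with nonzero diagonal entries, so an eigenvector for 0 is
  pushed down to the empty sum.\<close>

lemma weight_map_inj: "inj K"
proof -
  have "v = 0" if "K v = 0" for v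
  proof -
    have "v \<in> (\<Sum>j<0. Xs j)"
    proof (rule triangular_eigenvector[where N = "Suc d" and T = K and c = "\<lambda>i. q powi (int d - 2 * int i)" and l = 0])
      show "v \<in> (\<Sum>j<Suc d. Xs j)"
        using sum_Xs by (simp add: lessThan_Suc_atMost atLeast0AtMost)
      show "K v = 0 *s v" using that by simp
    qed (use weight_map_flag(1) subspace_Xs nz in \<open>auto simp del: sum.lessThan_Suc\<close>)
    then show ?thesis by (simp add: set_zero)
  qed
  then show ?thesis
    by (auto simp: K.inj_iff_eq_0)
qed

text \<open>\<open>K\<close> and \<open>B\<close> have the same diagonal entries, and the
  coefficients \<open>a\<close> and \<open>- inverse a\<close>, divided by
  \<open>a - inverse a\<close>, add up to 1.\<close>

lemma M_map_flag:
  assumes "i \<le> d" "v \<in> (\<Sum>j<Suc i. Xs j)"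
  shows "M_map scale a K B v - q powi (int d - 2 * int i) *s v \<in> (\<Sum>j<i. Xs j)"
proof -
  let ?k = "q powi (int d - 2 * int i)"
  have sub: "subspace (\<Sum>j<i. Xs j)"
    using assms(1) by (intro subspace_sum_Xs) auto
  have e: "a - inverse a \<noteq> 0"
    using nz by simp
  have "inverse (a - inverse a) *s (a *s (K v - ?k *s v) - inverse a *s (B v - ?k *s v)) \<in> (\<Sum>j<i. Xs j)"
    by (intro subspace_scale[OF sub, of _ "inverse (a - inverse a)"] subspace_diff[OF sub]
        subspace_scale[OF sub, of _ a] subspace_scale[OF sub, of _ "inverse a"] weight_map_flag[OF assms])
  moreover have "a *s (K v - ?k *s v) - inverse a *s (B v - ?k *s v)
      = a *s K v - inverse a *s B v - (a - inverse a) *s (?k *s v)"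
    by (simp add: algebra_simps)
  ultimately show ?thesis
    using e by (simp add: M_map_def scale_right_diff_distrib[of "inverse (a - inverse a)"] flip: mult.assoc)
qed

text \<open>Used with \<open>l = 0\<close> and \<open>n = 0\<close> for injectivity of
  \<open>M_map\<close>, and with \<open>l\<close> equal to q^d and \<open>n = 1\<close> to place
  \<open>W_space\<close> at index 0 inside \<open>Xs 0\<close>.\<close>

lemma M_map_eigenvector:
  assumes "M_map scale a K B v = l *s v" "n \<le> Suc d"
    and "\<And>i. n \<le> i \<Longrightarrow> i \<le> d \<Longrightarrow> q powi (int d - 2 * int i) \<noteq> l"
  shows "v \<in> (\<Sum>j<n. Xs j)"
proof (rule triangular_eigenvector[where N = "Suc d" and T = "M_map scale a K B"
      and c = "\<lambda>i. q powi (int d - 2 * int i)" and l = l])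
  show "v \<in> (\<Sum>j<Suc d. Xs j)"
    using sum_Xs by (simp add: lessThan_Suc_atMost atLeast0AtMost)
qed (use M_map_flag subspace_Xs assms in \<open>auto simp del: sum.lessThan_Suc\<close>)

end

end

section \<open>The action of \<open>psi_map\<close> on the eigenspaces of
  \<open>M_map\<close>\<close>

theorem lemma9p1:
  fixes scale :: "'k::alg_closed_field \<Rightarrow> 'v::ab_group_add \<Rightarrow> 'v"
    and Basis :: "'v set"
    and d :: nat
    and A As K B :: "'v \<Rightarrow> 'v"
    and E Es :: "nat \<Rightarrow> 'v \<Rightarrow> 'v"
    and q a b :: 'k
  assumes "finite_dimensional_vector_space scale Basis"
    and "vector_space.dim scale (UNIV :: 'v set) > 0"
    and "td_system scale d A E As Es"
    and "d \<ge> 1"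
    and "q_Racah_type scale d A E As Es q a b"
    and "q_weight_map scale d q (split_U d E Es) K"
    and "q_weight_map scale d q (split_U_down d E Es) B"
  shows "\<forall>i\<le>d. psi_map scale q a K B ` W_space scale d q a K B i
           \<subseteq> zero_ext d (W_space scale d q a K B) (int i - 1)"
proof (intro allI impI subsetI; elim imageE)
  interpret finite_dimensional_vector_space scale Basis by fact
  define th where "th = (\<lambda>i. a * q powi (int d - 2 * int i) + inverse a * q powi (2 * int i - int d))"
  define ths where "ths = (\<lambda>i. b * q powi (int d - 2 * int i) + inverse b * q powi (2 * int i - int d))"
  have q: "q \<noteq> 0" and a: "a \<noteq> 0"
    and A: "\<And>i v. i \<le> d \<Longrightarrow> v \<in> range (E i) \<Longrightarrow> A v = scale (th i) v"
    and As: "\<And>i v. i \<le> d \<Longrightarrow> v \<in> range (Es i) \<Longrightarrow> As v = scale (ths i) v"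
    using \<open>q_Racah_type scale d A E As Es q a b\<close> unfolding q_Racah_type_def th_def ths_def by blast+
  interpret tridiagonal_system scale d A As "\<lambda>i. range (E i)" "\<lambda>i. range (Es i)" th ths
    by (rule td_system_tridiagonal[OF \<open>td_system scale d A E As Es\<close> A As])
  interpret down: tridiagonal_system scale d A As "\<lambda>i. range (E (d - i))" "\<lambda>i. range (Es i)"
    "\<lambda>i. th (d - i)" ths
    by (rule reverse)
  have inj_th: "inj_on th {0..d}"
    using standard_ordering_inj[OF linear_A _ A] \<open>td_system scale d A E As Es\<close>
    by (auto simp: td_system_def)
  have a_inv: "a \<noteq> inverse a"
  proof
    \<comment> \<open>Then the first and last eigenvalues of \<open>A\<close> agree, although
      \<open>d\<close> is positive.\<close>
    assume "a = inverse a"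
    then have "th 0 = th d"
      unfolding th_def by (simp add: add.commute)
    then show False
      using inj_onD[OF inj_th, of 0 d] \<open>d \<ge> 1\<close> by simp
  qed
  have K: "Vector_Spaces.linear scale scale K"
    "\<And>i u. i \<le> d \<Longrightarrow> u \<in> U i \<Longrightarrow> K u = scale (q powi (int d - 2 * int i)) u"
    using \<open>q_weight_map scale d q (split_U d E Es) K\<close>
    by (auto simp: q_weight_map_def split_U_def U_def)
  have U_down: "down.U i = split_U_down d E Es i" if "i \<le> d" for i
  proof -
    have "(\<Sum>j\<in>{i..d}. range (E (d - j))) = (\<Sum>j\<in>{0..d - i}. range (E j))"
      using that by (intro sum.reindex_bij_witness[of _ "\<lambda>j. d - j" "\<lambda>j. d - j"]) auto
    then show ?thesis by (simp add: down.U_def split_U_down_def)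
  qed
  have B: "Vector_Spaces.linear scale scale B"
    "\<And>i u. i \<le> d \<Longrightarrow> u \<in> down.U i \<Longrightarrow> B u = scale (q powi (int d - 2 * int i)) u"
    using \<open>q_weight_map scale d q (split_U_down d E Es) B\<close>
    by (auto simp: q_weight_map_def U_down)
  note hyps = q a a_inv th_def ths_def K B
  interpret K: Vector_Spaces.linear scale scale K by fact
  interpret B: Vector_Spaces.linear scale scale B by fact
  let ?M = "M_map scale a K B"
  define k where "k i = q powi (int d - 2 * int i)" for i
  have k_nz: "k i \<noteq> 0" for i
    using q by (simp add: k_def)
  \<comment> \<open>The eigenvalue \<open>th i\<close> is a function of \<open>k i\<close>, so
    distinct eigenvalues force distinct weights.\<close>
  have k_inj: "i = 0" if "k i = k 0" "i \<le> d" for i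
  proof -
    have "th i = a * k i + inverse a * inverse (k i)" for i
      unfolding th_def k_def by (simp flip: power_int_minus)
    then show ?thesis
      using that inj_onD[OF inj_th, of i 0] by simp
  qed
  define e where "e = a - inverse a"
  have e: "e \<noteq> 0"
    using a_inv by (simp add: e_def)
  define D where "D v = K v - B v" for v
  define m where "m v = scale a (K v) - scale (inverse a) (B v)" for v
  have M_m: "?M v = scale (inverse e) (m v)" for v
    by (simp add: M_map_def m_def e_def)
  have D_scale: "D (scale c v) = scale c (D v)" for c v
    by (simp add: D_def K.scale B.scale scale_right_diff_distrib)
  have m_scale: "m (scale c v) = scale c (m v)" for c v
    by (simp add: m_def K.scale B.scale scale_right_diff_distrib mult.commute)
  have m_diff: "m (v - w) = m v - m w" for v w
    by (simp add: m_def K.diff B.diff scale_right_diff_distrib)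
  have m_D: "m (D v) = scale (q * q) (D (m v))" for v
    unfolding D_def m_def by (rule weight_maps_q_commute[OF hyps])
  have inj_K: "inj K"
    by (rule weight_map_inj[OF hyps])
  then have surj_K: "surj K"
    by (rule linear_inj_imp_surj[OF K(1)])
  have inj_m: "v = w" if "m v = m w" for v w
  proof -
    have M_0: "?M (v - w) = scale 0 (v - w)"
      using that by (simp add: M_m m_diff)
    have "v - w \<in> (\<Sum>j<0. range (Es j))"
      by (rule M_map_eigenvector[OF hyps M_0]) (use q in auto)
    then show ?thesis by (simp add: set_zero)
  qed
  \<comment> \<open>\<open>N\<close> is the map inverted in \<open>psi_map\<close>, and it equals
    \<open>q\<close> times \<open>m\<close> after \<open>inv K\<close>. Its injectivity is what
    allows \<open>inv N\<close> to be evaluated.\<close>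
  define N where "N v = scale q (scale a v - scale (inverse a) (B (inv K v)))" for v
  have N_K: "N (K v) = scale q (m v)" for v
    by (simp add: N_def m_def inv_f_f[OF inj_K])
  have inj_N: "inj N"
  proof (rule injI)
    fix v w assume eq: "N v = N w"
    obtain v' w' where "v = K v'" "w = K w'"
      using surj_K by (metis surjD)
    then show "v = w"
      using eq inj_m[of v' w'] q by (simp add: N_K)
  qed
  fix i v w
  assume i: "i \<le> d" and v: "v \<in> W_space scale d q a K B i" and w: "w = psi_map scale q a K B v"
  have M_v: "?M v = scale (k i) v"
    using v by (simp add: W_space_def eigenspace_def k_def)
  then have "scale e (?M v) = scale (e * k i) v"
    by simp
  then have m_v: "m v = scale (e * k i) v"
    using e by (simp add: M_m)
  \<comment> \<open>On the given \<open>v\<close>, \<open>m\<close> is multiplication by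
    \<open>e * k i\<close>; this \<open>c\<close> makes \<open>K (scale c v)\<close> the preimage of
    \<open>v\<close> under \<open>N\<close>.\<close>
  define c where "c = inverse (q * e * k i)"
  have "q * (c * (e * k i)) = 1"
    using q e k_nz[of i] by (simp add: c_def field_simps)
  then have "N (K (scale c v)) = v"
    by (simp add: N_K m_scale m_v)
  then have inv_N: "inv N v = K (scale c v)"
    by (rule inv_f_eq[OF inj_N])
  have psi: "w = scale c (D v)"
    unfolding w psi_map_def N_def[symmetric] o_def inv_N inv_f_f[OF inj_K] D_scale[symmetric]
    by (simp add: D_def)
  show "w \<in> zero_ext d (W_space scale d q a K B) (int i - 1)"
  proof (cases i)
    case 0
    \<comment> \<open>The target is \<open>{0}\<close>, and raising the eigenvalue by q^2 would not
      show that \<open>w\<close> vanishes. Instead \<open>v\<close> is located in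
      \<open>range (Es 0)\<close>, where \<open>K\<close> and \<open>B\<close> agree.\<close>
    have "v \<in> (\<Sum>j<1. range (Es j))"
      by (rule M_map_eigenvector[OF hyps M_v]) (use k_inj in \<open>auto simp: 0 k_def\<close>)
    then have "D v = 0"
      using weight_map_bottom[OF hyps] by (simp add: D_def)
    then show ?thesis
      by (simp add: psi 0 zero_ext_def)
  next
    case (Suc n)
    have "q * q * k i = q powi 2 * q powi (int d - 2 * int i)"
      by (simp add: k_def power2_eq_square)
    also have "\<dots> = q powi (2 + (int d - 2 * int i))"
      by (rule power_int_add[symmetric]) (simp add: q)
    also have "2 + (int d - 2 * int i) = int d - 2 * int n"
      by (simp add: Suc)
    finally have k: "q * q * k i = q powi (int d - 2 * int n)" .
    \<comment> \<open>\<open>m_D\<close> moves \<open>m\<close> past \<open>D\<close> at the cost of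
      q^2, which turns the weight of index \<open>i\<close> into that of index
      \<open>n\<close>.\<close>
    have "?M w = scale (inverse e * c * (q * q) * (e * k i)) (D v)"
      by (simp add: psi M_m m_scale m_D m_v D_scale mult.assoc)
    also have "inverse e * c * (q * q) * (e * k i) = (q * q * k i) * c"
      using e by simp
    finally have "w \<in> W_space scale d q a K B n"
      by (simp add: W_space_def eigenspace_def psi k)
    then show ?thesis
      using i by (simp add: Suc zero_ext_def)
  qed
qed

end
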